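(* Let $\mathcal F$ be a semifilter. Then for each cofinal $\mathfrak b(\mathcal F)$-scale $S=\{f_\alpha:\alpha<\mathfrak b(\mathcal F)\}$, the set $X=S\cup Q$, viewed as a subspace of $\overline{\mathbb N}^{\uparrow\mathbb N}$, satisfies $\mathbf B(\mathcal F)$.
   Context: $\mathbb N=\{0,1,2,\dots\}$, discrete; $\mathbb N^{\mathbb N}$ has the product topology. $[\mathbb N]^{\aleph_0}$ is the family of infinite subsets of $\mathbb N$; $A\subseteq^*B$ means $A\setminus B$ is finite. A semifilter is a nonempty $\mathcal F\subseteq[\mathbb N]^{\aleph_0}$ such that $A\in\mathcal F$, $B\subseteq\mathbb N$ and $A\subseteq^*B$ imply $B\in\mathcal F$. For $f,g\in\mathbb N^{\mathbb N}$, $f\le_{\mathcal F}g$ means $\{n:f(n)\le g(n)\}\in\mathcal F$. A set $Y\subseteq\mathbb N^{\mathbb N}$ is bounded with respect to $\le_{\mathcal F}$ if there is $g\in\mathbb N^{\mathbb N}$ with $f\le_{\mathcal F}g$ for all $f\in Y$; otherwise it is unbounded. $\mathfrak b(\mathcal F)$ is the minimal cardinality of a subset of $\mathbb N^{\mathbb N}$ that is unbounded with respect to $\le_{\mathcal F}$. A space $X$ satisfies $\mathbf B(\mathcal F)$ if each continuous image of $X$ in $\mathbb N^{\mathbb N}$ is bounded with respect to $\le_{\mathcal F}$. $\mathbb N^{\uparrow\mathbb N}$ is the set of (strictly) increasing elements of $\mathbb N^{\mathbb N}$. A cofinal $\mathfrak b(\mathcal F)$-scale is a family $\{f_\alpha:\alpha<\mathfrak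 b(\mathcal F)\}\subseteq\mathbb N^{\uparrow\mathbb N}$ such that (1) $f_\alpha\le_{\mathcal F}f_\beta$ for all $\alpha<\beta<\mathfrak b(\mathcal F)$; and (2) for each $g\in\mathbb N^{\mathbb N}$ there is $\alpha<\mathfrak b(\mathcal F)$ such that $g\le_{\mathcal F}f_\beta$ for each $\beta\ge\alpha$. $\overline{\mathbb N}=\mathbb N\cup\{\infty\}$ is the one-point compactification of $\mathbb N$. $\overline{\mathbb N}^{\uparrow\mathbb N}$ is the subspace of the product $\overline{\mathbb N}^{\mathbb N}$ consisting of the nondecreasing $f$ such that $f(n)<f(n+1)$ whenever $f(n)<\infty$. $Q$ is the (countable) set of all $f\in\overline{\mathbb N}^{\uparrow\mathbb N}$ that take the value $\infty$; thus $\overline{\mathbb N}^{\uparrow\mathbb N}=Q\cup\mathbb N^{\uparrow\mathbb N}$. *)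

theory Defs
  imports "HOL-Analysis.Analysis"
begin

unbundle cardinal_syntax

definition almost_subset :: "nat set \<Rightarrow> nat set \<Rightarrow> bool" where
  "almost_subset A B \<longleftrightarrow> finite (A - B)"

definition semifilter :: "nat set set \<Rightarrow> bool" where
  "semifilter F \<longleftrightarrow> F \<noteq> {} \<and> (\<forall>A\<in>F. infinite A) \<and>
     (\<forall>A B. A \<in> F \<longrightarrow> almost_subset A B \<longrightarrow> B \<in> F)"

definition le_wrt :: "nat set set \<Rightarrow> (nat \<Rightarrow> nat) \<Rightarrow> (nat \<Rightarrow> nat) \<Rightarrow> bool" where
  "le_wrt F f g \<longleftrightarrow> {n. f n \<le> g n} \<in> F"

definition bounded_wrt :: "nat set set \<Rightarrow> (nat \<Rightarrow> nat) set \<Rightarrow> bool" where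
  "bounded_wrt F Y \<longleftrightarrow> (\<exists>g. \<forall>f\<in>Y. le_wrt F f g)"

text \<open>
  A cardinal is represented, as usual in HOL, by a cardinal order \<open>r\<close> (a well-order of least
  possible order type on \<open>Field r\<close>), determined only up to order isomorphism. The ordinals below
  the cardinal are then the elements of \<open>Field r\<close>, and \<open>(\<alpha>, \<beta>) \<in> r\<close> says
  \<open>\<alpha> \<le> \<beta>\<close>. The predicate below says that \<open>r\<close> is the cardinal \<open>\<bb>(F)\<close>;
  lemma \<open>ex_is_frak_b\<close> shows that this cardinal exists.
\<close>

definition is_frak_b :: "nat set set \<Rightarrow> 'i rel \<Rightarrow> bool" where
  "is_frak_b F r \<longleftrightarrow> Card_order r \<and>
     (\<exists>Y :: (nat \<Rightarrow> nat) set. \<not> bounded_wrt F Y \<and> r =o |Y| ) \<and>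
     (\<forall>Z :: (nat \<Rightarrow> nat) set. \<not> bounded_wrt F Z \<longrightarrow> r \<le>o |Z| )"

lemma not_bounded_wrt_UNIV:
  assumes "semifilter F"
  shows "\<not> bounded_wrt F UNIV"
proof
  assume "bounded_wrt F UNIV"
  then obtain g where g: "le_wrt F f g" for f
    unfolding bounded_wrt_def by auto
  have "{} \<in> F"
    using g[of "\<lambda>n. Suc (g n)"] by (simp add: le_wrt_def)
  then show False
    using assms unfolding semifilter_def by blast
qed

lemma ex_is_frak_b:
  assumes "semifilter F"
  shows "\<exists>r :: (nat \<Rightarrow> nat) rel. is_frak_b F r"
proof -
  let ?R = "card_of ` {Y :: (nat \<Rightarrow> nat) set. \<not> bounded_wrt F Y}"
  have "?R \<noteq> {}"
    using not_bounded_wrt_UNIV[OF assms] by auto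
  moreover have "\<forall>r\<in>?R. Card_order r"
    by (auto simp: card_of_Card_order)
  ultimately obtain r where "r \<in> ?R" "\<forall>r'\<in>?R. r \<le>o r'"
    using exists_minim_Card_order[of ?R] by blast
  then have "is_frak_b F r"
    unfolding is_frak_b_def
    by (auto simp: card_of_Card_order intro: card_of_refl)
  then show ?thesis ..
qed

definition cofinal_scale :: "nat set set \<Rightarrow> 'i rel \<Rightarrow> ('i \<Rightarrow> nat \<Rightarrow> nat) \<Rightarrow> bool" where
  "cofinal_scale F r f \<longleftrightarrow>
     is_frak_b F r \<and>
     (\<forall>\<alpha>\<in>Field r. strict_mono (f \<alpha>)) \<and>
     (\<forall>\<alpha> \<beta>. (\<alpha>, \<beta>) \<in> r \<longrightarrow> \<alpha> \<noteq> \<beta> \<longrightarrow> le_wrt F (f \<alpha>) (f \<beta>)) \<and>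
     (\<forall>g. \<exists>\<alpha>\<in>Field r. \<forall>\<beta>. (\<alpha>, \<beta>) \<in> r \<longrightarrow> le_wrt F g (f \<beta>))"

text \<open>
  The canonical topology of \<^typ>\<open>nat \<Rightarrow> nat\<close> is the product of discrete topologies.
\<close>

definition satisfies_B :: "nat set set \<Rightarrow> 'x topology \<Rightarrow> bool" where
  "satisfies_B F T \<longleftrightarrow>
     (\<forall>\<Phi>. continuous_map T (euclidean :: (nat \<Rightarrow> nat) topology) \<Phi> \<longrightarrow>
        bounded_wrt F (\<Phi> ` topspace T))"

text \<open>
  The order topology on \<^typ>\<open>enat\<close> is that of the one-point compactification of the discrete
  space of natural numbers (see \<open>open_enat_iff\<close>), and \<^typ>\<open>nat \<Rightarrow> enat\<close> carries the
  product topology.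
\<close>

definition ext_incr :: "(nat \<Rightarrow> enat) set" where
  "ext_incr = {f. mono f \<and> (\<forall>n. f n < \<infinity> \<longrightarrow> f n < f (Suc n))}"

definition ext_incr_space :: "(nat \<Rightarrow> enat) topology" where
  "ext_incr_space = subtopology euclidean ext_incr"

definition Q :: "(nat \<Rightarrow> enat) set" where
  "Q = {f \<in> ext_incr. \<exists>n. f n = \<infinity>}"

definition emb :: "(nat \<Rightarrow> nat) \<Rightarrow> nat \<Rightarrow> enat" where
  "emb f = (\<lambda>n. enat (f n))"

end

theory Submission
  imports Defs
begin

text \<open>
  The points of \<open>ext_incr\<close> taking the value \<open>\<infinity>\<close> at \<open>n\<close> form a compact subset of \<open>Q\<close>, so near them
  the \<open>n\<close>-th coordinate of a continuous \<open>\<Phi>\<close> is bounded. This gives a single \<open>g\<close> such that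
  \<open>x n > g n\<close> implies \<open>\<Phi> x n \<le> g n\<close>. Hence \<open>g\<close> bounds \<open>\<Phi>\<close> on \<open>Q\<close> (whose elements are eventually
  \<open>\<infinity>\<close>) and on a final segment of the scale; the images of the remaining fewer than \<open>\<bb>(F)\<close> points
  are bounded by some \<open>h\<close>, and the pointwise maximum of \<open>g\<close> and \<open>h\<close> bounds everything.
\<close>

text \<open>Since \<open>\<infinity> + 1 = \<infinity>\<close>, one non-strict inequality covers
  finite and infinite values alike. Being a conjunction of non-strict inequalities between
  continuous functions, it shows that \<open>ext_incr\<close> is closed.\<close>

lemma ext_incr_iff: "x \<in> ext_incr \<longleftrightarrow> (\<forall>n. x n + 1 \<le> x (Suc n))"
proof
  assume x: "x \<in> ext_incr"
  show "\<forall>n. x n + 1 \<le> x (Suc n)"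
  proof
    fix n
    have "x n \<le> x (Suc n)" "x n < \<infinity> \<longrightarrow> x n < x (Suc n)"
      using x by (auto simp: ext_incr_def mono_def)
    then show "x n + 1 \<le> x (Suc n)"
      by (cases "x n") (auto simp: ileI1 plus_1_eSuc)
  qed
next
  assume x: "\<forall>n. x n + 1 \<le> x (Suc n)"
  have "x n \<le> x (Suc n)" for n
    using x[rule_format, of n] by (metis ile_eSuc order_trans plus_1_eSuc(2))
  moreover have "x n < x (Suc n)" if "x n < \<infinity>" for n
    using x[rule_format, of n] that
    by (metis enat_ord_simps(4) iless_Suc_eq not_infinity_eq order_less_le_trans order_refl plus_1_eSuc(2))
  ultimately show "x \<in> ext_incr"
    by (simp add: ext_incr_def mono_iff_le_Suc)
qed

lemma compact_ext_incr: "compact ext_incr"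
proof -
  have "compact (UNIV :: (nat \<Rightarrow> enat) set)"
    using compact_space_product_topology[of "\<lambda>_::nat. euclidean :: enat topology" UNIV]
    by (simp add: compact_UNIV euclidean_product_topology compact_space_def)
  moreover have "closed ext_incr"
  proof -
    have "ext_incr = {x. \<forall>n. x n + 1 \<le> x (Suc n)}"
      using ext_incr_iff by auto
    also have "closed \<dots>"
      by (intro closed_Collect_all closed_Collect_le continuous_intros
          continuous_on_product_coordinates)
    finally show ?thesis .
  qed
  ultimately show ?thesis
    using closed_Int_compact[of ext_incr UNIV] by simp
qed

lemma continuous_on_bounded_near_infinity:
  fixes h :: "(nat \<Rightarrow> enat) \<Rightarrow> nat"
  assumes "Q \<subseteq> A" and "continuous_on A h"
  shows "\<exists>m. \<forall>x \<in> A \<inter> ext_incr. x n > enat m \<longrightarrow> h x \<le> m"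
proof -
  \<comment> \<open>\<open>h\<close> is continuous only on \<open>A\<close>, which need not be
    compact; extending the relatively open preimages to open sets of the whole space lets the
    compactness of \<open>ext_incr\<close> be used.\<close>
  have "\<exists>V. open V \<and> V \<inter> A = h -` {..<k} \<inter> A" for k
    using assms(2) open_lessThan[of k] unfolding continuous_on_open_invariant by blast
  then obtain V where V: "open (V k)" "V k \<inter> A = h -` {..<k} \<inter> A" for k
    by metis
  \<comment> \<open>The second piece absorbs the points with finite coordinate \<open>n\<close>,
    which may lie outside \<open>A\<close>; the remaining points of \<open>ext_incr\<close> are in
    \<open>Q\<close>, hence in \<open>A\<close>, where \<open>V\<close> reaches them.\<close>
  define U where "U = (\<lambda>k. V k \<union> {x. x n < enat k})"
  have "open (U k)" for k
    unfolding U_def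
    by (intro open_Un V open_Collect_less continuous_intros continuous_on_product_coordinates)
  moreover have "ext_incr \<subseteq> (\<Union>k. U k)"
  proof
    fix x assume x: "x \<in> ext_incr"
    show "x \<in> (\<Union>k. U k)"
    proof (cases "x n")
      case (enat j)
      then have "x \<in> U (Suc j)" by (simp add: U_def)
      then show ?thesis by blast
    next
      case infinity
      then have "x \<in> A" using x assms(1) by (auto simp: Q_def)
      then have "x \<in> V (Suc (h x)) \<inter> A" unfolding V by simp
      then show ?thesis by (auto simp: U_def)
    qed
  qed
  ultimately obtain C where C: "finite C" "ext_incr \<subseteq> (\<Union>k\<in>C. U k)"
    using compactE_image[OF compact_ext_incr, of UNIV U] by auto
  \<comment> \<open>\<open>Max C\<close> serves as threshold and as bound: a coordinate above it
    rules out the second piece of every \<open>U k\<close> with \<open>k\<close> in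
    \<open>C\<close>.\<close>
  have "h x \<le> Max C" if x: "x \<in> A \<inter> ext_incr" and gt: "x n > enat (Max C)" for x
  proof -
    obtain k where k: "k \<in> C" "x \<in> U k" using C(2) x by blast
    then have kM: "k \<le> Max C" using C(1) by simp
    then have "\<not> x n < enat k"
      using gt by (meson enat_ord_simps(1) le_less_trans less_asym not_le)
    then have "x \<in> V k \<inter> A" using k(2) x by (simp add: U_def)
    then show ?thesis unfolding V using kM by simp
  qed
  then show ?thesis by blast
qed

lemma semifilter_mono:
  assumes "semifilter F" "A \<in> F" "A \<subseteq> B"
  shows "B \<in> F"
  using assms by (metis Diff_eq_empty_iff almost_subset_def finite.emptyI semifilter_def)

lemma semifilter_cofinite:
  assumes "semifilter F" "finite (- B)"
  shows "B \<in> F"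
proof -
  obtain A where "A \<in> F" using assms(1) by (auto simp: semifilter_def)
  moreover have "finite (A - B)" using assms(2) by (rule rev_finite_subset) auto
  ultimately show ?thesis using assms(1) unfolding semifilter_def almost_subset_def by blast
qed

lemma le_wrt_trans_pointwise:
  assumes "semifilter F" "le_wrt F f g" "\<And>n. g n \<le> h n"
  shows "le_wrt F f h"
  using semifilter_mono[OF assms(1)] assms(2,3) unfolding le_wrt_def
  by (metis (mono_tags, lifting) Collect_mono order_trans)

text \<open>A semifilter need not be closed under intersection, but passing to the pointwise maximum
  only enlarges the witnessing set of each single function.\<close>

lemma bounded_wrt_Un:
  assumes "semifilter F" "bounded_wrt F Y" "bounded_wrt F Z"
  shows "bounded_wrt F (Y \<union> Z)"
proof -
  obtain g h where "\<forall>f\<in>Y. le_wrt F f g" "\<forall>f\<in>Z. le_wrt F f h"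
    using assms(2,3) by (auto simp: bounded_wrt_def)
  then have "\<forall>f\<in>Y \<union> Z. le_wrt F f (\<lambda>n. max (g n) (h n))"
    by (metis Un_iff le_wrt_trans_pointwise[OF assms(1)] max.cobounded1 max.cobounded2)
  then show ?thesis unfolding bounded_wrt_def by (rule exI[where x = "\<lambda>n. max (g n) (h n)"])
qed

theorem theorem2p24:
  fixes F :: "nat set set" and r :: "'i rel" and f :: "'i \<Rightarrow> nat \<Rightarrow> nat"
  assumes "semifilter F"
    and "cofinal_scale F r f"
  shows "satisfies_B F (subtopology ext_incr_space (emb ` (f ` Field r) \<union> Q))"
  unfolding satisfies_B_def
proof (intro allI impI)
  define A where "A = emb ` (f ` Field r) \<union> Q"
  let ?T = "subtopology ext_incr_space (emb ` (f ` Field r) \<union> Q)"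
  fix \<Phi> :: "(nat \<Rightarrow> enat) \<Rightarrow> nat \<Rightarrow> nat"
  assume cont: "continuous_map ?T euclidean \<Phi>"
  have b: "is_frak_b F r" and mono: "\<And>\<alpha>. \<alpha> \<in> Field r \<Longrightarrow> strict_mono (f \<alpha>)"
    and cof: "\<And>g. \<exists>\<alpha>\<in>Field r. \<forall>\<beta>. (\<alpha>, \<beta>) \<in> r \<longrightarrow> le_wrt F g (f \<beta>)"
    using assms(2) by (auto simp: cofinal_scale_def)
  have card: "Card_order r" using b by (simp add: is_frak_b_def)
  have "emb (f \<alpha>) \<in> ext_incr" if "\<alpha> \<in> Field r" for \<alpha>
    using mono[OF that] by (auto simp: ext_incr_def emb_def mono_def strict_mono_less_eq strict_mono_less)
  then have A_sub: "A \<subseteq> ext_incr" by (auto simp: A_def Q_def)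
  then have T: "?T = subtopology euclidean A"
    by (simp add: A_def[symmetric] ext_incr_space_def subtopology_subtopology inf_absorb2)
  have "continuous_on A \<Phi>" using cont unfolding T by simp
  then have "continuous_on A (\<lambda>x. \<Phi> x n)" for n
    by (rule continuous_on_product_then_coordinatewise)
  then have "\<exists>m. \<forall>x \<in> A \<inter> ext_incr. x n > enat m \<longrightarrow> \<Phi> x n \<le> m" for n
    by (intro continuous_on_bounded_near_infinity) (auto simp: A_def)
  then obtain g where g: "\<And>n x. x \<in> A \<Longrightarrow> x n > enat (g n) \<Longrightarrow> \<Phi> x n \<le> g n"
    using A_sub by (metis IntI subsetD)
  \<comment> \<open>The successor turns domination by the scale into the strict inequality that
    \<open>g\<close> requires.\<close>
  obtain \<alpha> where \<alpha>: "\<alpha> \<in> Field r" "\<And>\<beta>. (\<alpha>, \<beta>) \<in> r \<Longrightarrow> le_wrt F (\<lambda>n. Suc (g n)) (f \<beta>)"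
    using cof[of "\<lambda>n. Suc (g n)"] by blast

  have "le_wrt F (\<Phi> q) g" if q: "q \<in> Q" for q
  proof -
    obtain k where k: "q k = \<infinity>" using q by (auto simp: Q_def)
    have "\<Phi> q n \<le> g n" if "k \<le> n" for n
    proof (rule g)
      have "q k \<le> q n" using q that by (auto simp: Q_def ext_incr_def mono_def)
      then show "enat (g n) < q n" using k by simp
    qed (use q A_def in auto)
    then have "- {n. \<Phi> q n \<le> g n} \<subseteq> {..<k}"
      by (auto simp: not_le[symmetric])
    then show ?thesis
      unfolding le_wrt_def
      using semifilter_cofinite[OF assms(1)] finite_subset by blast
  qed
  then have "bounded_wrt F (\<Phi> ` Q)" by (auto simp: bounded_wrt_def)
  moreover have "le_wrt F (\<Phi> (emb (f \<beta>))) g" if "(\<alpha>, \<beta>) \<in> r" for \<beta>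
  proof -
    have "emb (f \<beta>) \<in> A" using that by (auto simp: A_def Field_def)
    then have "{n. Suc (g n) \<le> f \<beta> n} \<subseteq> {n. \<Phi> (emb (f \<beta>)) n \<le> g n}"
      using g by (auto simp: emb_def)
    then show ?thesis
      using \<alpha>(2)[OF that] semifilter_mono[OF assms(1)] unfolding le_wrt_def by blast
  qed
  then have "bounded_wrt F ((\<lambda>\<beta>. \<Phi> (emb (f \<beta>))) ` {\<beta>. (\<alpha>, \<beta>) \<in> r})"
    by (auto simp: bounded_wrt_def)
  \<comment> \<open>A proper initial segment of a cardinal order has smaller cardinality, so its
    image is too small to be unbounded.\<close>
  moreover have "bounded_wrt F ((\<lambda>\<beta>. \<Phi> (emb (f \<beta>))) ` underS r \<alpha>)" (is "bounded_wrt F ?Z")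
  proof (rule ccontr)
    assume "\<not> bounded_wrt F ?Z"
    then have "r \<le>o |?Z|" using b by (auto simp: is_frak_b_def)
    also have "|?Z| \<le>o |underS r \<alpha>|" by (rule card_of_image)
    also have "|underS r \<alpha>| <o r" using card \<alpha>(1) by (rule card_of_underS)
    finally show False using not_ordLess_ordIso ordLess_irreflexive by blast
  qed
  ultimately have "bounded_wrt F (\<Phi> ` Q \<union> ((\<lambda>\<beta>. \<Phi> (emb (f \<beta>))) ` {\<beta>. (\<alpha>, \<beta>) \<in> r} \<union> ?Z))"
    by (intro bounded_wrt_Un[OF assms(1)])
  moreover have "\<Phi> ` topspace ?T \<subseteq>
      \<Phi> ` Q \<union> ((\<lambda>\<beta>. \<Phi> (emb (f \<beta>))) ` {\<beta>. (\<alpha>, \<beta>) \<in> r} \<union> ?Z)"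
  proof -
    \<comment> \<open>Totality of \<open>r\<close> splits the scale at \<open>\<alpha>\<close> into
      the two families just bounded.\<close>
    have "wo_rel r" using card by (simp add: card_order_on_def wo_rel_def)
    then have "(\<alpha>, \<beta>) \<in> r \<or> (\<beta>, \<alpha>) \<in> r" if "\<beta> \<in> Field r" for \<beta>
      using that \<alpha>(1) wo_rel.TOTALS by blast
    then have "(\<alpha>, \<beta>) \<in> r \<or> \<beta> \<in> underS r \<alpha>" if "\<beta> \<in> Field r" for \<beta>
      using that unfolding underS_def by blast
    then show ?thesis unfolding T by (auto simp: A_def)
  qed
  ultimately show "bounded_wrt F (\<Phi> ` topspace ?T)"
    unfolding bounded_wrt_def by (meson subsetD)
qed

end
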